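(* Let $P$ be the Borel probability measure on $\mathbb{R}^2$ that is uniform on its support $\{(x,y)\in\mathbb{R}^2:0\le x\le2,\ y=0\}$. For $n\in\mathbb{N}$, let $\alpha_n:=\{(a_i,1):1\le i\le n\}$, with $a_1<a_2<\cdots<a_n$, be an optimal set of $n$-points for $P$ with respect to the constraint $S=\{(x,1):\tfrac12\le x\le\tfrac32\}$ (i.e., the elements of the optimal set lie on the line $y=1$ between $(\frac12,1)$ and $(\frac32,1)$). Then $\alpha_1=\{(1,1)\}$, $\alpha_2=\{(\frac12,1),(\frac32,1)\}$, and for $n\ge3$, $$a_i=\begin{cases}\frac12 & \text{if } i=1,\\ \frac12+\frac{i-1}{n-1} & \text{if } 2\le i\le n-1,\\ \frac32 & \text{if } i=n,\end{cases}$$ and the quantization error for $n$-points is $V_n=\dfrac{25n^2-50n+26}{24(n-1)^2}$.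
   Context: Here $r=2$ and distances on $\mathbb{R}^2$ are Euclidean. For finite nonempty $\alpha\subseteq S$, $V(P;\alpha)=\int\min_{p\in\alpha}\|x-p\|^2\,dP(x)$; the $n$th constrained quantization error is $V_n=V_n(P)=\inf\{V(P;\alpha):\alpha\subseteq S,\ 1\le\mathrm{card}(\alpha)\le n\}$; an optimal set of $n$-points with respect to $S$ is a set $\alpha\subseteq S$ with $1\le\mathrm{card}(\alpha)\le n$ and $V(P;\alpha)=V_n$. *)

theory Defs
  imports "HOL-Probability.Probability"
begin

text \<open>
  The norm of the product type \<open>real \<times> real\<close> is the Euclidean one, so this type serves as the
  Euclidean plane.
\<close>

definition distortion :: "(real \<times> real) measure \<Rightarrow> (real \<times> real) set \<Rightarrow> real" where
  "distortion P \<alpha> = (\<integral>x. Min ((\<lambda>p. (norm (x - p))\<^sup>2) ` \<alpha>) \<partial>P)"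

text \<open>The condition \<open>1 \<le> card \<alpha>\<close> entails that \<open>\<alpha>\<close> is finite and nonempty.\<close>

definition admissible_sets :: "(real \<times> real) set \<Rightarrow> nat \<Rightarrow> (real \<times> real) set set" where
  "admissible_sets S n = {\<alpha>. \<alpha> \<subseteq> S \<and> 1 \<le> card \<alpha> \<and> card \<alpha> \<le> n}"

definition quantization_error ::
    "(real \<times> real) measure \<Rightarrow> (real \<times> real) set \<Rightarrow> nat \<Rightarrow> real" where
  "quantization_error P S n = (INF \<alpha>\<in>admissible_sets S n. distortion P \<alpha>)"

definition optimal_set ::
    "(real \<times> real) measure \<Rightarrow> (real \<times> real) set \<Rightarrow> nat \<Rightarrow> (real \<times> real) set \<Rightarrow> bool" where
  "optimal_set P S n \<alpha> \<longleftrightarrow>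
     \<alpha> \<in> admissible_sets S n \<and> distortion P \<alpha> = quantization_error P S n"

text \<open>
  The segment is a null set of the plane, so its uniform distribution is not a
  \<^const>\<open>uniform_measure\<close> of planar Lebesgue measure; it is the image of the uniform distribution
  on \<open>[0, 2]\<close> under the isometric embedding \<open>x \<mapsto> (x, 0)\<close>.
\<close>

definition segment_uniform :: "(real \<times> real) measure" where
  "segment_uniform = distr (uniform_measure lborel {0..2}) borel (\<lambda>x. (x, 0))"

definition constraint_segment :: "(real \<times> real) set" where
  "constraint_segment = {(x, 1) | x. 1 / 2 \<le> x \<and> x \<le> 3 / 2}"

definition points_at_height_one :: "nat \<Rightarrow> (nat \<Rightarrow> real) \<Rightarrow> (real \<times> real) set" where
  "points_at_height_one n a = {(a i, 1) | i. 1 \<le> i \<and> i \<le> n}"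

end

theory Submission imports Defs begin

text \<open>
  Cutting \<open>[0, 2]\<close> at the points \<open>a\<^sub>1 < \<dots> < a\<^sub>m\<close> and at the midpoints between them turns twice the
  distortion, minus the constant 2 coming from the height, into
  \<open>a\<^sub>1\<^sup>3/3 + \<Sum> (a\<^sub>i\<^sub>+\<^sub>1 - a\<^sub>i)\<^sup>3/12 + (2 - a\<^sub>m)\<^sup>3/3\<close>. Replacing every cube by its tangent line at the
  conjectured optimum (ends of length \<open>1/2\<close>, gaps of length \<open>h = 1/(n - 1)\<close>) leaves a linear
  remainder that is nonnegative because \<open>a\<^sub>1 \<ge> 1/2\<close>, \<open>a\<^sub>m \<le> 3/2\<close>, \<open>h \<le> 1\<close> and \<open>m \<le> n\<close>. The defect
  vanishes only when all lengths are the conjectured ones.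
\<close>

section \<open>Integration against a uniform distribution on an interval\<close>

text \<open>Nonnegativity allows a detour through \<open>nn_integral\<close>, so a gauge integral
  transfers to the Bochner integral without a separate integrability proof.\<close>

lemma integral_uniform_measure_Icc:
  fixes f :: "real \<Rightarrow> real"
  assumes "a < b" and f[measurable]: "f \<in> borel_measurable borel" and nonneg: "\<And>x. 0 \<le> f x"
    and I: "(f has_integral I) {a..b}"
  shows "integral\<^sup>L (uniform_measure lborel {a..b}) f = I / (b - a)"
proof -
  let ?f = "\<lambda>x. f x * indicator {a..b} x"
  have I0: "0 \<le> I"
    using has_integral_nonneg[OF I] nonneg by blast
  have "(?f has_integral I) UNIV"
    using I has_integral_restrict_UNIV[of "{a..b}" f I]
    by (simp add: indicator_def of_bool_def if_distrib cong: if_cong)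
  then have "(\<integral>\<^sup>+x. ennreal (?f x) \<partial>lborel) = ennreal I"
    by (intro nn_integral_has_integral_lborel) (auto simp: nonneg)
  moreover have "(\<integral>\<^sup>+x. ennreal (?f x) \<partial>lborel) = (\<integral>\<^sup>+x. ennreal (f x) * indicator {a..b} x \<partial>lborel)"
    by (intro nn_integral_cong) (auto simp: indicator_def)
  ultimately have "(\<integral>\<^sup>+x. f x \<partial>uniform_measure lborel {a..b}) = ennreal I / ennreal (b - a)"
    using \<open>a < b\<close> by (subst nn_integral_uniform_measure) auto
  then show ?thesis
    using I0 \<open>a < b\<close> nonneg by (subst integral_eq_nn_integral) (auto simp: divide_ennreal)
qed

lemma has_integral_square_shift:
  fixes c :: real
  assumes "p \<le> q"
  shows "((\<lambda>x. (x - c)\<^sup>2) has_integral ((q - c) ^ 3 / 3 - (p - c) ^ 3 / 3)) {p..q}"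
  using assms
  by (intro fundamental_theorem_of_calculus)
     (auto intro!: derivative_eq_intros simp: has_real_derivative_iff_has_vector_derivative[symmetric])

section \<open>Squared distance to a finite set of reals\<close>

text \<open>The squared distance from \<open>(x, 0)\<close> to \<open>(t, 1)\<close> is
  \<open>(x - t)\<^sup>2 + 1\<close>, so up to the constant 1 this is the integrand of the planar
  distortion.\<close>

definition squared_distance_to :: "real set \<Rightarrow> real \<Rightarrow> real" where
  "squared_distance_to A x = Min ((\<lambda>a. (x - a)\<^sup>2) ` A)"

lemma squared_distance_to_eq:
  assumes "finite A" "c \<in> A" "\<And>a. a \<in> A \<Longrightarrow> \<bar>x - c\<bar> \<le> \<bar>x - a\<bar>"
  shows "squared_distance_to A x = (x - c)\<^sup>2"
  unfolding squared_distance_to_def using assms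
  by (intro Min_eqI) (auto simp: abs_le_square_iff)

lemma squared_distance_to_nonneg:
  "finite A \<Longrightarrow> A \<noteq> {} \<Longrightarrow> 0 \<le> squared_distance_to A x"
  unfolding squared_distance_to_def by (subst Min_ge_iff) auto

lemma borel_measurable_squared_distance_to [measurable]:
  "finite A \<Longrightarrow> squared_distance_to A \<in> borel_measurable borel"
  unfolding squared_distance_to_def[abs_def] by measurable

text \<open>The last hypothesis places \<open>{p..q}\<close> inside the Voronoi cell of
  \<open>c\<close>, where the minimum is a single parabola.\<close>

lemma has_integral_squared_distance_to:
  assumes "finite A" "c \<in> A" "p \<le> q"
    and "\<And>x a. p \<le> x \<Longrightarrow> x \<le> q \<Longrightarrow> a \<in> A \<Longrightarrow> \<bar>x - c\<bar> \<le> \<bar>x - a\<bar>"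
  shows "(squared_distance_to A has_integral ((q - c) ^ 3 / 3 - (p - c) ^ 3 / 3)) {p..q}"
  using has_integral_square_shift[OF \<open>p \<le> q\<close>, of c]
  by (rule has_integral_eq[rotated]) (use assms in \<open>auto intro: squared_distance_to_eq[symmetric]\<close>)

text \<open>The Voronoi boundary between neighbours is their midpoint; each half of the gap
  contributes \<open>(d - c) ^ 3 / 24\<close>.\<close>

lemma has_integral_squared_distance_to_gap:
  assumes "finite A" "c \<in> A" "d \<in> A" "c < d" and gap: "\<And>a. a \<in> A \<Longrightarrow> a \<le> c \<or> d \<le> a"
  shows "(squared_distance_to A has_integral (d - c) ^ 3 / 12) {c..d}"
proof -
  define m where "m = (c + d) / 2"
  have m: "c \<le> m" "m \<le> d"
    using \<open>c < d\<close> by (auto simp: m_def)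
  have left: "\<bar>x - c\<bar> \<le> \<bar>x - t\<bar>" if "c \<le> x" "x \<le> m" "t \<in> A" for x t
    using gap[OF \<open>t \<in> A\<close>] that unfolding m_def by (auto simp: abs_if)
  have right: "\<bar>x - d\<bar> \<le> \<bar>x - t\<bar>" if "m \<le> x" "x \<le> d" "t \<in> A" for x t
    using gap[OF \<open>t \<in> A\<close>] that unfolding m_def by (auto simp: abs_if)
  have "(squared_distance_to A has_integral ((m - c) ^ 3 / 3 - (c - c) ^ 3 / 3)) {c..m}"
    by (rule has_integral_squared_distance_to[OF assms(1,2) m(1) left])
  moreover have "(squared_distance_to A has_integral ((d - d) ^ 3 / 3 - (m - d) ^ 3 / 3)) {m..d}"
    by (rule has_integral_squared_distance_to[OF assms(1,3) m(2) right])
  ultimately have "(squared_distance_to A has_integral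
      ((m - c) ^ 3 / 3 - (c - c) ^ 3 / 3 + ((d - d) ^ 3 / 3 - (m - d) ^ 3 / 3))) {c..d}"
    using m by (intro has_integral_combine)
  also have "(m - c) ^ 3 / 3 - (c - c) ^ 3 / 3 + ((d - d) ^ 3 / 3 - (m - d) ^ 3 / 3) = (d - c) ^ 3 / 12"
    by (simp add: m_def field_simps power3_eq_cube)
  finally show ?thesis .
qed

section \<open>Cost of an increasing configuration\<close>

text \<open>The terms are the end piece left of the first point, the gaps, and the end piece right
  of the last point. For \<open>m = 1\<close> the sum is empty and both end terms concern the same
  point.\<close>

definition segment_cost :: "nat \<Rightarrow> (nat \<Rightarrow> real) \<Rightarrow> real" where
  "segment_cost m a = a 1 ^ 3 / 3 + (\<Sum>i\<in>{1..<m}. (a (Suc i) - a i) ^ 3 / 12) + (2 - a m) ^ 3 / 3"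

lemma has_integral_squared_distance_to_strict_mono:
  assumes mono: "strict_mono_on {1..m} a" and "1 \<le> m" and "0 \<le> a 1" "a m \<le> 2"
  shows "(squared_distance_to (a ` {1..m}) has_integral segment_cost m a) {0..2}"
proof -
  let ?A = "a ` {1..m}"
  have le: "a i \<le> a j" if "1 \<le> i" "i \<le> j" "j \<le> m" for i j
    using strict_mono_on_leD[OF mono] that by auto
  have in_A: "a 1 \<in> ?A" "a m \<in> ?A"
    using \<open>1 \<le> m\<close> by auto
  have bounds: "a 1 \<le> t" "t \<le> a m" if "t \<in> ?A" for t
    using le \<open>1 \<le> m\<close> that by auto
  \<comment> \<open>The point set \<open>?A\<close> stays fixed; induction on \<open>k\<close> moves
    only the right endpoint, appending one gap at a time.\<close>
  have left: "(squared_distance_to ?A has_integral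
      (a 1 ^ 3 / 3 + (\<Sum>i\<in>{1..<k}. (a (Suc i) - a i) ^ 3 / 12))) {0..a k}"
    if "1 \<le> k" "k \<le> m" for k
    using that
  proof (induction k rule: dec_induct)
    case base
    have "(squared_distance_to ?A has_integral ((a 1 - a 1) ^ 3 / 3 - (0 - a 1) ^ 3 / 3)) {0..a 1}"
      using in_A \<open>0 \<le> a 1\<close> bounds(1)
      by (intro has_integral_squared_distance_to) (simp, simp, simp, smt (verit))
    then show ?case by simp
  next
    case (step k)
    have "a i \<le> a k \<or> a (Suc k) \<le> a i" if "i \<in> {1..m}" for i
      using le[of i k] le[of "Suc k" i] that step by (cases "i \<le> k") auto
    then have "t \<le> a k \<or> a (Suc k) \<le> t" if "t \<in> ?A" for t
      using that by blast
    moreover have "a k < a (Suc k)"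
      using step strict_mono_onD[OF mono, of k "Suc k"] by simp
    ultimately have gap: "(squared_distance_to ?A has_integral (a (Suc k) - a k) ^ 3 / 12) {a k..a (Suc k)}"
      using step by (intro has_integral_squared_distance_to_gap) simp_all
    have "0 \<le> a k" "a k \<le> a (Suc k)"
      using le[of 1 k] le[of k "Suc k"] \<open>0 \<le> a 1\<close> step by simp_all
    from has_integral_combine[OF this step.IH gap] show ?case
      using step by (simp add: add.assoc)
  qed
  have "(squared_distance_to ?A has_integral ((2 - a m) ^ 3 / 3 - (a m - a m) ^ 3 / 3)) {a m..2}"
    using in_A \<open>a m \<le> 2\<close> bounds(2)
    by (intro has_integral_squared_distance_to) (simp, simp, simp, smt (verit))
  from has_integral_combine[OF _ \<open>a m \<le> 2\<close> left[OF \<open>1 \<le> m\<close> order_refl] this] show ?thesis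
    unfolding segment_cost_def using bounds(1)[OF in_A(2)] \<open>0 \<le> a 1\<close> by simp
qed

section \<open>Planar distortion and admissible sets in terms of abscissae\<close>

lemma points_at_height_one_eq: "points_at_height_one n a = (\<lambda>t. (t, 1)) ` a ` {1..n}"
  by (auto simp: points_at_height_one_def)

text \<open>The unit height leaves the minimum as an additive constant, which integrates to 2 over
  \<open>{0..2}\<close>; normalising by the length 2 then halves \<open>I + 2\<close>.\<close>

lemma distortion_segment_uniform_height_one:
  assumes A: "finite A" "A \<noteq> {}" and I: "(squared_distance_to A has_integral I) {0..2}"
  shows "distortion segment_uniform ((\<lambda>t. (t, 1)) ` A) = 1 + I / 2"
proof -
  let ?\<mu> = "uniform_measure lborel {0..2::real}"
  have "distortion segment_uniform ((\<lambda>t. (t, 1)) ` A)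
      = (\<integral>x. Min ((\<lambda>p. (norm ((x, 0 :: real) - p))\<^sup>2) ` (\<lambda>t. (t, 1)) ` A) \<partial>?\<mu>)"
    unfolding distortion_def segment_uniform_def
    using A by (subst integral_distr) auto
  also have "\<dots> = (\<integral>x. squared_distance_to A x + 1 \<partial>?\<mu>)"
  proof (rule Bochner_Integration.integral_cong[OF refl])
    fix x :: real
    show "Min ((\<lambda>p. (norm ((x, 0 :: real) - p))\<^sup>2) ` (\<lambda>t. (t, 1)) ` A) = squared_distance_to A x + 1"
      unfolding squared_distance_to_def using A
      by (subst Min_add_commute[symmetric]) (auto simp: image_image norm_Pair)
  qed
  also have "\<dots> = (I + 2) / (2 - 0)"
  proof (rule integral_uniform_measure_Icc)
    show "((\<lambda>x. squared_distance_to A x + 1) has_integral I + 2) {0..2}"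
      using has_integral_add[OF I has_integral_const_real[of "1::real" 0 2]] by simp
  qed (use A in \<open>auto intro: add_nonneg_nonneg squared_distance_to_nonneg\<close>)
  finally show ?thesis by simp
qed

lemma distortion_points_at_height_one:
  assumes "strict_mono_on {1..m} a" "1 \<le> m" "0 \<le> a 1" "a m \<le> 2"
  shows "distortion segment_uniform (points_at_height_one m a) = 1 + segment_cost m a / 2"
  unfolding points_at_height_one_eq
  by (rule distortion_segment_uniform_height_one[OF _ _
      has_integral_squared_distance_to_strict_mono[OF assms]]) (use \<open>1 \<le> m\<close> in simp_all)

text \<open>Strict monotonicity makes the cardinality exactly \<open>m\<close>, and by monotonicity
  the constraint only has to be checked at the two extreme points.\<close>

lemma admissible_points_at_height_one_iff:
  assumes mono: "strict_mono_on {1..m} a"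
  shows "points_at_height_one m a \<in> admissible_sets constraint_segment n
    \<longleftrightarrow> 1 \<le> m \<and> m \<le> n \<and> 1 / 2 \<le> a 1 \<and> a m \<le> 3 / 2"
proof -
  have "inj_on (\<lambda>i. (a i, 1 :: real)) {1..m}"
    by (intro inj_onI) (auto dest: inj_onD[OF strict_mono_on_imp_inj_on[OF mono]])
  then have "card (points_at_height_one m a) = m"
    by (simp add: points_at_height_one_eq image_image card_image)
  moreover have "points_at_height_one m a \<subseteq> constraint_segment \<longleftrightarrow> 1 / 2 \<le> a 1 \<and> a m \<le> 3 / 2"
    if "1 \<le> m"
  proof -
    have "a 1 \<le> a i \<and> a i \<le> a m" if "1 \<le> i" "i \<le> m" for i
      using strict_mono_on_leD[OF mono, of 1 i] strict_mono_on_leD[OF mono, of i m] that by auto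
    then have "(\<forall>i\<in>{1..m}. 1 / 2 \<le> a i \<and> a i \<le> 3 / 2) \<longleftrightarrow> 1 / 2 \<le> a 1 \<and> a m \<le> 3 / 2"
      using that by (meson atLeastAtMost_iff order_refl order_trans)
    moreover have "points_at_height_one m a \<subseteq> constraint_segment
        \<longleftrightarrow> (\<forall>i\<in>{1..m}. 1 / 2 \<le> a i \<and> a i \<le> 3 / 2)"
      unfolding points_at_height_one_eq constraint_segment_def by (simp add: image_subset_iff)
    ultimately show ?thesis by simp
  qed
  ultimately show ?thesis
    by (auto simp: admissible_sets_def)
qed

lemma finite_real_set_enumeration:
  fixes A :: "real set"
  assumes "finite A"
  obtains a where "strict_mono_on {1..card A} a" "a ` {1..card A} = A"
proof -
  obtain xs where xs: "sorted_wrt (<) xs" "set xs = A" "length xs = card A"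
    using that[OF strict_sorted_list_of_set, of A] assms by simp
  \<comment> \<open>List positions start at 0 and the enumeration at 1, hence the shift.\<close>
  have "strict_mono_on {1..card A} (\<lambda>i. xs ! (i - 1))"
    by (intro strict_mono_onI sorted_wrt_nth_less[OF xs(1)]) (auto simp: xs(3))
  moreover have "(\<lambda>i. xs ! (i - 1)) ` {1..card A} = (\<lambda>i. xs ! (i - 1)) ` Suc ` {..<length xs}"
    by (simp only: xs(3) image_Suc_lessThan)
  moreover have "\<dots> = (!) xs ` {0..<length xs}"
    by (simp only: image_image diff_Suc_1 lessThan_atLeast0)
  moreover have "\<dots> = A"
    using nth_image[of "length xs" xs] xs(2) by simp
  ultimately show thesis
    using that by simp
qed

text \<open>This brings every competitor into the form to which the cost formula applies; the bounds
  on \<open>m\<close> and \<open>a\<close> then follow from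
  \<open>admissible_points_at_height_one_iff\<close>.\<close>

lemma admissible_sets_constraint_segmentE:
  assumes "\<alpha> \<in> admissible_sets constraint_segment n"
  obtains m a where "strict_mono_on {1..m} a" "\<alpha> = points_at_height_one m a"
proof -
  \<comment> \<open>Infinite sets have cardinality 0, so positivity yields finiteness.\<close>
  have "0 < card \<alpha>"
    using assms by (simp add: admissible_sets_def)
  then have "finite (fst ` \<alpha>)"
    by (intro finite_imageI card_ge_0_finite)
  then obtain a where a: "strict_mono_on {1..card (fst ` \<alpha>)} a" "a ` {1..card (fst ` \<alpha>)} = fst ` \<alpha>"
    by (rule finite_real_set_enumeration)
  have "(fst p, 1) = p" if "p \<in> \<alpha>" for p
  proof -
    have "p \<in> constraint_segment"
      using assms that by (auto simp: admissible_sets_def)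
    then show ?thesis
      by (auto simp: constraint_segment_def)
  qed
  then have "(\<lambda>t. (t, 1)) ` fst ` \<alpha> = \<alpha>"
    by (simp add: image_image)
  then have "\<alpha> = points_at_height_one (card (fst ` \<alpha>)) a"
    unfolding points_at_height_one_eq a(2) by (rule sym)
  with a(1) show thesis
    by (rule that)
qed

lemma distortion_nonneg:
  assumes "finite \<gamma>" "\<gamma> \<noteq> {}"
  shows "0 \<le> distortion P \<gamma>"
proof -
  have "0 \<le> Min ((\<lambda>p. (norm (x - p))\<^sup>2) ` \<gamma>)" for x
    using assms by (intro Min.boundedI) auto
  then show ?thesis
    unfolding distortion_def by (rule Bochner_Integration.integral_nonneg)
qed

text \<open>Serves the one-point case, where optimality is tested against an explicit competitor
  without computing the infimum.\<close>

lemma optimal_set_imp_distortion_le: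
  assumes "optimal_set P S n \<alpha>" "\<beta> \<in> admissible_sets S n"
  shows "distortion P \<alpha> \<le> distortion P \<beta>"
proof -
  \<comment> \<open>A real \<open>INF\<close> is known to be a lower bound only when the set of
    values is bounded below; here 0 is a bound.\<close>
  have "bdd_below (distortion P ` admissible_sets S n)"
  proof (rule bdd_belowI2)
    fix \<gamma> assume "\<gamma> \<in> admissible_sets S n"
    then have "0 < card \<gamma>"
      by (simp add: admissible_sets_def)
    then show "0 \<le> distortion P \<gamma>"
      by (intro distortion_nonneg) (simp_all add: card_gt_0_iff)
  qed
  from cINF_lower[OF this assms(2)] show ?thesis
    using assms(1) unfolding optimal_set_def quantization_error_def by linarith
qed

section \<open>Tangent-line lower bound and its equality case\<close>

text \<open>Summing the tangent-line identities \<open>d\<^sup>3 = 3h\<^sup>2d - 2h\<^sup>3 + (d - h)\<^sup>2(d + 2h)\<close> over the gaps, and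
  \<open>t\<^sup>3 = 3t/4 - 1/4 + (t - 1/2)\<^sup>2(t + 1)\<close> for the two end pieces, makes every defect term visibly
  nonnegative.\<close>

lemma segment_cost_eq:
  assumes "1 \<le> m" "m \<le> n" "2 \<le> n" and h: "h = 1 / (real n - 1)"
  shows "segment_cost m a = (1 + h\<^sup>2) / 12
    + (a 1 - 1 / 2)\<^sup>2 * (a 1 + 1) / 3 + (3 / 2 - a m)\<^sup>2 * (3 - a m) / 3
    + (a 1 - 1 / 2 + (3 / 2 - a m)) * (1 - h\<^sup>2) / 4 + h ^ 3 * (real n - real m) / 6
    + (\<Sum>i\<in>{1..<m}. (a (Suc i) - a i - h)\<^sup>2 * (a (Suc i) - a i + 2 * h)) / 12"
proof -
  have telescope: "(\<Sum>i\<in>{1..<m}. a (Suc i)) - sum a {1..<m} = a m - a 1"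
    using sum_Suc_diff'[OF \<open>1 \<le> m\<close>, of a] by (simp add: sum_subtractf)
  have "(\<Sum>i\<in>{1..<m}. (a (Suc i) - a i) ^ 3 / 12)
      = (\<Sum>i\<in>{1..<m}. (a (Suc i) - a i - h)\<^sup>2 * (a (Suc i) - a i + 2 * h) / 12
          + h\<^sup>2 / 4 * (a (Suc i) - a i) - h ^ 3 / 6)"
    by (intro sum.cong refl) (simp add: field_simps power2_eq_square power3_eq_cube)
  also have "\<dots> = (\<Sum>i\<in>{1..<m}. (a (Suc i) - a i - h)\<^sup>2 * (a (Suc i) - a i + 2 * h)) / 12
          + h\<^sup>2 / 4 * (a m - a 1) - h ^ 3 * (real m - 1) / 6"
    using \<open>1 \<le> m\<close>
    by (simp add: sum.distrib sum_subtractf sum_divide_distrib[symmetric] sum_distrib_left[symmetric]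
        telescope mult.commute of_nat_diff del: One_nat_def)
  finally have S: "(\<Sum>i\<in>{1..<m}. (a (Suc i) - a i) ^ 3 / 12) = \<dots>" .
  \<comment> \<open>Writing \<open>h\<^sup>2\<close> as \<open>n - 1\<close> copies of
    \<open>h ^ 3\<close> turns the \<open>m - 1\<close> gap constants into \<open>h\<^sup>2\<close>
    minus a deficit proportional to \<open>n - m\<close>.\<close>
  have "h * (real n - 1) = 1"
    using assms by simp
  then have "h\<^sup>2 = h ^ 3 * (real n - 1)"
    by (simp add: power3_eq_cube power2_eq_square mult.assoc)
  then have h3: "h ^ 3 * (real m - 1) = h\<^sup>2 - h ^ 3 * (real n - real m)"
    by (simp add: algebra_simps)
  have left: "a 1 ^ 3 / 3 = 1 / 24 + (a 1 - 1 / 2) / 4 + (a 1 - 1 / 2)\<^sup>2 * (a 1 + 1) / 3"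
    by (simp add: field_simps power2_eq_square power3_eq_cube)
  have right: "(2 - a m) ^ 3 / 3 = 1 / 24 + (3 / 2 - a m) / 4 + (3 / 2 - a m)\<^sup>2 * (3 - a m) / 3"
    by (simp add: field_simps power2_eq_square power3_eq_cube)
  show ?thesis
    unfolding segment_cost_def S h3 left right
    by (simp add: algebra_simps diff_divide_distrib add_divide_distrib)
qed

text \<open>In the equality case all nonnegative defects vanish. The end points and gaps are read
  off from the squares, whose cofactors \<open>a 1 + 1\<close>, \<open>3 - a m\<close> and
  \<open>a (Suc i) - a i + 2 * h\<close> are positive. This also works for \<open>n = 2\<close>,
  where \<open>h = 1\<close> and the linear end term \<open>?C\<close> is identically 0.\<close>

lemma segment_cost_bound:
  assumes "1 \<le> m" "m \<le> n" "2 \<le> n" and h: "h = 1 / (real n - 1)"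
    and "1 / 2 \<le> a 1" "a m \<le> 3 / 2" and mono: "strict_mono_on {1..m} a"
  shows segment_cost_ge: "(1 + h\<^sup>2) / 12 \<le> segment_cost m a"
    and segment_cost_le_imp: "segment_cost m a \<le> (1 + h\<^sup>2) / 12 \<Longrightarrow>
      a 1 = 1 / 2 \<and> a m = 3 / 2 \<and> (\<forall>i\<in>{1..<m}. a (Suc i) = a i + h)"
proof -
  let ?A = "(a 1 - 1 / 2)\<^sup>2 * (a 1 + 1) / 3"
  let ?B = "(3 / 2 - a m)\<^sup>2 * (3 - a m) / 3"
  let ?C = "(a 1 - 1 / 2 + (3 / 2 - a m)) * (1 - h\<^sup>2) / 4"
  let ?D = "h ^ 3 * (real n - real m) / 6"
  let ?f = "\<lambda>i. (a (Suc i) - a i - h)\<^sup>2 * (a (Suc i) - a i + 2 * h)"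
  have h01: "0 < h" "h \<le> 1"
    using \<open>2 \<le> n\<close> by (auto simp: h)
  then have "h\<^sup>2 \<le> 1"
    by (simp add: power_le_one)
  have gap: "0 < a (Suc i) - a i" if "i \<in> {1..<m}" for i
    using strict_mono_onD[OF mono, of i "Suc i"] that by auto
  have f: "0 \<le> ?f i" if "i \<in> {1..<m}" for i
    using gap[OF that] h01 by simp
  have nonneg: "0 \<le> ?A" "0 \<le> ?B" "0 \<le> ?C" "0 \<le> ?D" "0 \<le> (\<Sum>i\<in>{1..<m}. ?f i)"
    using assms(1,2,5,6) h01 \<open>h\<^sup>2 \<le> 1\<close> by (auto intro!: sum_nonneg f)
  note eq = segment_cost_eq[OF assms(1-4), of a]
  show "(1 + h\<^sup>2) / 12 \<le> segment_cost m a"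
    using nonneg eq by linarith
  assume "segment_cost m a \<le> (1 + h\<^sup>2) / 12"
  then have zero: "?A = 0" "?B = 0" "(\<Sum>i\<in>{1..<m}. ?f i) = 0"
    using nonneg eq by linarith+
  have "a (Suc i) = a i + h" if "i \<in> {1..<m}" for i
  proof -
    have "?f i = 0"
      using zero(3) f that by (subst (asm) sum_nonneg_eq_0_iff) blast+
    then show ?thesis
      using gap[OF that] h01 by simp
  qed
  then show "a 1 = 1 / 2 \<and> a m = 3 / 2 \<and> (\<forall>i\<in>{1..<m}. a (Suc i) = a i + h)"
    using zero(1,2) assms(5,6) by simp
qed

section \<open>The equispaced configuration and the quantization error\<close>

text \<open>One formula covers both ends and the interior for \<open>n\<close> at least 2. At
  \<open>n = 1\<close> division by zero would give 1/2, whereas the optimum is 1, so that case is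
  treated apart.\<close>

definition equispaced :: "nat \<Rightarrow> nat \<Rightarrow> real" where
  "equispaced n i = 1 / 2 + (real i - 1) / (real n - 1)"

lemma
  assumes "2 \<le> n"
  shows equispaced_strict_mono: "strict_mono_on {1..n} (equispaced n)"
    and equispaced_first: "equispaced n 1 = 1 / 2"
    and equispaced_last: "equispaced n n = 3 / 2"
    and segment_cost_equispaced: "segment_cost n (equispaced n) = (1 + (1 / (real n - 1))\<^sup>2) / 12"
proof -
  show "strict_mono_on {1..n} (equispaced n)"
    using assms by (intro strict_mono_onI) (auto simp: equispaced_def divide_strict_right_mono)
  show *: "equispaced n 1 = 1 / 2" "equispaced n n = 3 / 2"
    using assms by (auto simp: equispaced_def)
  have diff: "equispaced n (Suc i) - equispaced n i = 1 / (real n - 1)" for i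
    by (simp add: equispaced_def diff_divide_distrib[symmetric])
  \<comment> \<open>There are \<open>n - 1\<close> gaps of length \<open>1 / (n - 1)\<close>, so one
    power cancels and the lower bound is met exactly.\<close>
  have "(real n - 1) * (1 / (real n - 1)) ^ 3 = (1 / (real n - 1))\<^sup>2"
    using assms by (simp add: power3_eq_cube power2_eq_square)
  moreover have "segment_cost n (equispaced n) = 1 / 12 + (real n - 1) * (1 / (real n - 1)) ^ 3 / 12"
    unfolding segment_cost_def * diff using assms by (simp add: of_nat_diff power3_eq_cube)
  ultimately show "segment_cost n (equispaced n) = (1 + (1 / (real n - 1))\<^sup>2) / 12"
    by simp
qed

lemma admissible_equispaced:
  "2 \<le> n \<Longrightarrow> points_at_height_one n (equispaced n) \<in> admissible_sets constraint_segment n"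
  by (simp add: admissible_points_at_height_one_iff equispaced_strict_mono
      equispaced_first equispaced_last del: One_nat_def)

lemma distortion_equispaced:
  assumes "2 \<le> n"
  shows "distortion segment_uniform (points_at_height_one n (equispaced n))
    = 1 + (1 + (1 / (real n - 1))\<^sup>2) / 24"
  using assms
  by (simp add: distortion_points_at_height_one equispaced_strict_mono equispaced_first
      equispaced_last segment_cost_equispaced del: One_nat_def)

text \<open>The infimum is a minimum: \<open>equispaced n\<close> attains it, and
  \<open>segment_cost_ge\<close> bounds every competitor, including those with fewer than
  \<open>n\<close> points.\<close>

lemma quantization_error_segment:
  assumes "2 \<le> n"
  shows "quantization_error segment_uniform constraint_segment n = 1 + (1 + (1 / (real n - 1))\<^sup>2) / 24"
  unfolding quantization_error_def
proof (rule cInf_eq_minimum)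
  show "1 + (1 + (1 / (real n - 1))\<^sup>2) / 24
      \<in> distortion segment_uniform ` admissible_sets constraint_segment n"
    using admissible_equispaced[OF assms] distortion_equispaced[OF assms, symmetric]
    by (rule rev_image_eqI)
next
  fix d assume "d \<in> distortion segment_uniform ` admissible_sets constraint_segment n"
  then obtain \<alpha> where \<alpha>: "\<alpha> \<in> admissible_sets constraint_segment n"
    and d: "d = distortion segment_uniform \<alpha>"
    by blast
  from \<alpha> obtain m a where a: "strict_mono_on {1..m} a" "\<alpha> = points_at_height_one m a"
    by (rule admissible_sets_constraint_segmentE)
  with \<alpha> have *: "1 \<le> m" "m \<le> n" "1 / 2 \<le> a 1" "a m \<le> 3 / 2"
    by (simp_all add: admissible_points_at_height_one_iff)
  show "1 + (1 + (1 / (real n - 1))\<^sup>2) / 24 \<le> d"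
    using segment_cost_ge[OF *(1,2) assms refl *(3,4) a(1)] distortion_points_at_height_one[OF a(1)] * a(2) d
    by simp
qed

section \<open>Uniqueness of the optimal sets\<close>

text \<open>Optimality gives equality in the tangent-line bound, which fixes the first point and
  every increment; induction on the index does the rest.\<close>

lemma optimal_imp_equispaced:
  assumes "2 \<le> n" and mono: "strict_mono_on {1..n} a"
    and opt: "optimal_set segment_uniform constraint_segment n (points_at_height_one n a)"
    and "i \<in> {1..n}"
  shows "a i = equispaced n i"
proof -
  have *: "1 \<le> n" "1 / 2 \<le> a 1" "a n \<le> 3 / 2"
    using opt mono by (simp_all add: optimal_set_def admissible_points_at_height_one_iff)
  have "1 + segment_cost n a / 2 = 1 + (1 + (1 / (real n - 1))\<^sup>2) / 24"
    using opt distortion_points_at_height_one[OF mono] *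
      quantization_error_segment[OF assms(1)] by (simp add: optimal_set_def)
  then have a: "a 1 = 1 / 2" "\<And>i. i \<in> {1..<n} \<Longrightarrow> a (Suc i) = a i + 1 / (real n - 1)"
    using segment_cost_le_imp[OF *(1) order_refl assms(1) refl *(2,3) mono] by auto
  have "1 \<le> i" "i \<le> n"
    using assms by auto
  then show ?thesis
  proof (induction i rule: dec_induct)
    case base
    then show ?case using a(1) by (simp add: equispaced_def)
  next
    case (step i)
    then show ?case using a(2)[of i] by (simp add: equispaced_def add_divide_distrib diff_divide_distrib)
  qed
qed

text \<open>With one point there is no gap length \<open>h\<close>, but the cost is an explicit
  quadratic with its unique minimum at 1.\<close>

lemma optimal_singleton:
  assumes opt: "optimal_set segment_uniform constraint_segment 1 (points_at_height_one 1 a)"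
  shows "a 1 = 1"
proof -
  have mono: "strict_mono_on {1..1::nat} b" for b :: "nat \<Rightarrow> real"
    by (auto intro: strict_mono_onI)
  have dist: "distortion segment_uniform (points_at_height_one 1 b) = 1 + segment_cost 1 b / 2"
    if "1 / 2 \<le> b 1" "b 1 \<le> 3 / 2" for b
    using that by (intro distortion_points_at_height_one mono) auto
  have cost: "segment_cost 1 b = 2 / 3 + 2 * (b 1 - 1)\<^sup>2" for b
    by (simp add: segment_cost_def field_simps power2_eq_square power3_eq_cube)
  have a: "1 / 2 \<le> a 1" "a 1 \<le> 3 / 2"
    using opt mono by (auto simp: optimal_set_def admissible_points_at_height_one_iff)
  \<comment> \<open>The competitor is \<open>(1, 1)\<close>; a constant function is strictly
    increasing on a one-element index set.\<close>
  have "points_at_height_one 1 (\<lambda>_. 1) \<in> admissible_sets constraint_segment 1"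
    by (subst admissible_points_at_height_one_iff[OF mono]) auto
  from optimal_set_imp_distortion_le[OF opt this] have "(a 1 - 1)\<^sup>2 \<le> 0"
    unfolding dist[of a, OF a] by (subst (asm) dist) (auto simp: cost[simplified])
  then show ?thesis by simp
qed

theorem theorem3p7:
  fixes n :: nat
  assumes "1 \<le> n"
  shows "(\<forall>a :: nat \<Rightarrow> real.
            strict_mono_on {1..n} a \<and>
            optimal_set segment_uniform constraint_segment n (points_at_height_one n a) \<longrightarrow>
              (n = 1 \<longrightarrow> points_at_height_one n a = {(1, 1)}) \<and>
              (n = 2 \<longrightarrow> points_at_height_one n a = {(1 / 2, 1), (3 / 2, 1)}) \<and>
              (3 \<le> n \<longrightarrow> (\<forall>i\<in>{1..n}.
                 a i = (if i = 1 then 1 / 2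
                        else if i \<le> n - 1 then 1 / 2 + (real i - 1) / (real n - 1)
                        else 3 / 2))))
         \<and> (3 \<le> n \<longrightarrow>
              quantization_error segment_uniform constraint_segment n =
                (25 * (real n)\<^sup>2 - 50 * real n + 26) / (24 * (real n - 1)\<^sup>2))"
proof (intro conjI allI impI ballI; (elim conjE)?)
  fix a :: "nat \<Rightarrow> real"
  assume mono: "strict_mono_on {1..n} a"
    and opt: "optimal_set segment_uniform constraint_segment n (points_at_height_one n a)"
  {
    assume "n = 1"
    with opt have "a 1 = 1"
      using optimal_singleton by simp
    with \<open>n = 1\<close> show "points_at_height_one n a = {(1, 1)}"
      by (simp add: points_at_height_one_eq)
  next
    assume "n = 2"
    then have a: "a 1 = 1 / 2" "a 2 = 3 / 2"
      using optimal_imp_equispaced[OF _ mono opt] by (auto simp: equispaced_def)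
    have "{1..2::nat} = {1, 2}"
      by auto
    then show "points_at_height_one n a = {(1 / 2, 1), (3 / 2, 1)}"
      using \<open>n = 2\<close> by (simp add: points_at_height_one_eq a del: One_nat_def)
  next
    fix i assume "3 \<le> n" "i \<in> {1..n}"
    then have "a i = equispaced n i"
      using optimal_imp_equispaced[OF _ mono opt] by simp
    moreover have "i = n" if "\<not> i \<le> n - 1"
      using that \<open>i \<in> {1..n}\<close> by auto
    ultimately show "a i = (if i = 1 then 1 / 2
        else if i \<le> n - 1 then 1 / 2 + (real i - 1) / (real n - 1) else 3 / 2)"
      using \<open>3 \<le> n\<close> equispaced_first[of n] equispaced_last[of n]
      by (cases "i \<le> n - 1"; cases "i = 1") (simp_all add: equispaced_def del: One_nat_def)
  }
next
  assume "3 \<le> n"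
  \<comment> \<open>Completing the square matches the stated fraction with
    \<open>1 + (1 + h\<^sup>2) / 24 = (25 + h\<^sup>2) / 24\<close> for
    \<open>h = 1 / (n - 1)\<close>.\<close>
  have "25 * (real n)\<^sup>2 - 50 * real n + 26 = 25 * (real n - 1)\<^sup>2 + 1"
    by (simp add: power2_eq_square algebra_simps)
  then show "quantization_error segment_uniform constraint_segment n =
      (25 * (real n)\<^sup>2 - 50 * real n + 26) / (24 * (real n - 1)\<^sup>2)"
    using \<open>3 \<le> n\<close> by (simp only:) (simp add: quantization_error_segment add_divide_distrib power_divide)
qed

end
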